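(* Let $K=\mathbb{C}$ or $K=\mathbb{R}$, let $n\geq 2$ be an integer and let $A\in\mathcal{M}_n(K)$. Then the following conditions are equivalent: (i) For every $X\in\mathcal{M}_n(K)$, $\det(AX+XA)=0$. (ii) For every $X\in\mathcal{M}_n(K)$, $\mathrm{adj}(AX+XA)\, A+A\,\mathrm{adj}(AX+XA)=0_n$.
   Context: $\mathcal{M}_n(K)$ denotes the set of $n\times n$ matrices with entries in $K$, $0_n$ is the zero $n\times n$ matrix, and $\mathrm{adj}(M)$ denotes the classical adjoint (adjugate, i.e. transpose of the cofactor matrix) of $M$. *)

theory Defs
  imports Complex_Main "Jordan_Normal_Form.Determinant"
begin

end

theory Submission
  imports Defs "Jordan_Normal_Form.Char_Poly"
begin

text \<open>
  Put \<open>f X = det (A X + X A)\<close>. By Jacobi's formula and cyclicity of the trace, the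
  derivative of \<open>f\<close> at \<open>X\<close> in direction \<open>H\<close> is the trace of \<open>(adj M A + A adj M) H\<close>,
  where \<open>M = A X + X A\<close>. If \<open>f\<close> vanishes identically, so do all these derivatives; taking
  \<open>H\<close> among the matrix units gives (ii). Conversely, direction \<open>H = X\<close> is Euler's relation:
  the trace of \<open>(adj M A + A adj M) X\<close> equals that of \<open>adj M M\<close>, which is \<open>n det M\<close>, so (ii)
  forces \<open>det M = 0\<close>. The argument works over any field of characteristic 0.
\<close>

text \<open>In the Leibniz formula the product rule turns each term into a sum over the row
  \<open>i\<close> whose factor is differentiated. Swapping the two sums collects, for each
  \<open>i\<close>, the Leibniz formula of \<open>B\<close> with row \<open>i\<close>
  differentiated.\<close>

lemma pderiv_det:
  fixes B :: "'a :: idom poly mat"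
  assumes B: "B \<in> carrier_mat n n"
  shows "pderiv (det B) =
    (\<Sum>i<n. det (mat n n (\<lambda>(k, j). if k = i then pderiv (B $$ (k, j)) else B $$ (k, j))))"
proof -
  let ?P = "{p. p permutes {0..<n}}"
  let ?R = "\<lambda>i. mat n n (\<lambda>(k, j). if k = i then pderiv (B $$ (k, j)) else B $$ (k, j))"
  have row: "(\<Prod>k = 0..<n. ?R i $$ (k, p k)) =
      (\<Prod>k\<in>{0..<n} - {i}. B $$ (k, p k)) * pderiv (B $$ (i, p i))"
    if p: "p permutes {0..<n}" and i: "i \<in> {0..<n}" for p i
  proof -
    have pk: "p k < n" if "k < n" for k
      using permutes_in_image[OF p, of k] that by simp
    have "(\<Prod>k = 0..<n. ?R i $$ (k, p k)) =
        ?R i $$ (i, p i) * (\<Prod>k\<in>{0..<n} - {i}. ?R i $$ (k, p k))"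
      using i by (intro prod.remove) auto
    also have "(\<Prod>k\<in>{0..<n} - {i}. ?R i $$ (k, p k)) = (\<Prod>k\<in>{0..<n} - {i}. B $$ (k, p k))"
      by (intro prod.cong) (auto simp: pk)
    finally show ?thesis using i pk[of i] by (simp add: mult.commute)
  qed
  have "pderiv (det B) = (\<Sum>p\<in>?P. pderiv (signof p * (\<Prod>k = 0..<n. B $$ (k, p k))))"
    unfolding det_def'[OF B] pderiv_sum ..
  also have "\<dots> = (\<Sum>p\<in>?P. \<Sum>i = 0..<n. signof p * (\<Prod>k = 0..<n. ?R i $$ (k, p k)))"
  proof (rule sum.cong[OF refl])
    fix p assume "p \<in> ?P"
    then have p: "p permutes {0..<n}" by simp
    \<comment> \<open>The sign is the constant polynomial 1 or -1, so only the product of entries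
      contributes to the derivative.\<close>
    have "pderiv (signof p :: 'a poly) = 0"
      by (cases p rule: sign_cases) (simp_all add: pderiv_minus)
    then have "pderiv (signof p * (\<Prod>k = 0..<n. B $$ (k, p k))) =
        signof p * (\<Sum>i = 0..<n. (\<Prod>k\<in>{0..<n} - {i}. B $$ (k, p k)) * pderiv (B $$ (i, p i)))"
      by (simp add: pderiv_mult pderiv_prod)
    also have "\<dots> = (\<Sum>i = 0..<n. signof p * (\<Prod>k = 0..<n. ?R i $$ (k, p k)))"
      unfolding sum_distrib_left by (intro sum.cong) (simp_all only: row[OF p])
    finally show "pderiv (signof p * (\<Prod>k = 0..<n. B $$ (k, p k))) =
        (\<Sum>i = 0..<n. signof p * (\<Prod>k = 0..<n. ?R i $$ (k, p k)))" .
  qed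
  also have "\<dots> = (\<Sum>i = 0..<n. \<Sum>p\<in>?P. signof p * (\<Prod>k = 0..<n. ?R i $$ (k, p k)))"
    by (rule sum.swap)
  also have "\<dots> = (\<Sum>i<n. det (?R i))"
    unfolding lessThan_atLeast0 by (intro sum.cong refl det_def'[symmetric]) simp
  finally show ?thesis .
qed

lemma poly_det:
  fixes B :: "'a :: comm_ring_1 poly mat"
  shows "poly (det B) a = det (map_mat (\<lambda>p. poly p a) B)"
  by (rule comm_ring_hom.hom_det[OF poly_hom.comm_ring_hom_axioms, symmetric])

text \<open>Laplace expansion along row \<open>i\<close>: the cofactors of that row are computed
  after deleting it, so they are the same as those of \<open>M\<close>.\<close>

lemma det_replace_row:
  fixes M N :: "'a :: comm_ring_1 mat"
  assumes M: "M \<in> carrier_mat n n" and i: "i < n"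
  shows "det (mat n n (\<lambda>(k, j). if k = i then N $$ (k, j) else M $$ (k, j))) =
    (\<Sum>j<n. N $$ (i, j) * cofactor M i j)"
proof -
  let ?R = "mat n n (\<lambda>(k, j). if k = i then N $$ (k, j) else M $$ (k, j))"
  have "mat_delete ?R i j = mat_delete M i j" if "j < n" for j
    using M i that by (intro eq_matI) (auto simp: mat_delete_def)
  then have "cofactor ?R i j = cofactor M i j" if "j < n" for j
    using that by (simp add: cofactor_def)
  then show ?thesis
    using i by (subst laplace_expansion_row[of _ n i]) (auto intro!: sum.cong)
qed

text \<open>The polynomial matrix is the line \<open>M + x N\<close> in the indeterminate
  \<open>x\<close>. Differentiating row \<open>i\<close> leaves row \<open>i\<close> of
  \<open>N\<close>, and evaluating at 0 turns the other rows into those of \<open>M\<close>;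
  expanding along row \<open>i\<close> gives the inner sum.\<close>

lemma jacobi_formula_at_0:
  fixes M N :: "'a :: idom mat"
  assumes M: "M \<in> carrier_mat n n" and N: "N \<in> carrier_mat n n"
  shows "poly (pderiv (det (mat n n (\<lambda>(i, j). [:M $$ (i, j), N $$ (i, j):])))) 0 =
    (\<Sum>i<n. \<Sum>j<n. N $$ (i, j) * cofactor M i j)"
proof -
  let ?B = "mat n n (\<lambda>(i, j). [:M $$ (i, j), N $$ (i, j):])"
  let ?R = "\<lambda>i. mat n n (\<lambda>(k, j). if k = i then pderiv (?B $$ (k, j)) else ?B $$ (k, j))"
  have "map_mat (\<lambda>p. poly p 0) (?R i) =
      mat n n (\<lambda>(k, j). if k = i then N $$ (k, j) else M $$ (k, j))" for i
    by (rule eq_matI) (auto simp: pderiv_pCons)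
  then have "poly (det (?R i)) 0 = (\<Sum>j<n. N $$ (i, j) * cofactor M i j)" if "i < n" for i
    using det_replace_row[OF M that, of N] by (simp add: poly_det)
  then show ?thesis
    by (subst pderiv_det[of _ n]) (auto simp: poly_sum)
qed

text \<open>The determinant along the line is a polynomial in \<open>t\<close>. Characteristic 0
  makes the domain infinite, so vanishing at every \<open>t\<close> makes it the zero polynomial,
  and its derivative at 0 vanishes too.\<close>

lemma sum_cofactor_eq_0_if_det_line_eq_0:
  fixes M N :: "'a :: {idom, ring_char_0} mat"
  assumes M: "M \<in> carrier_mat n n" and N: "N \<in> carrier_mat n n"
    and line: "\<And>t. det (M + t \<cdot>\<^sub>m N) = 0"
  shows "(\<Sum>i<n. \<Sum>j<n. N $$ (i, j) * cofactor M i j) = 0"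
proof -
  let ?B = "mat n n (\<lambda>(i, j). [:M $$ (i, j), N $$ (i, j):])"
  have "map_mat (\<lambda>p. poly p t) ?B = M + t \<cdot>\<^sub>m N" for t
    using M N by (intro eq_matI) auto
  then have "det ?B = 0"
    using line by (intro poly_all_0_iff_0[THEN iffD1]) (simp add: poly_det)
  then show ?thesis
    using jacobi_formula_at_0[OF M N] by simp
qed

lemma sum_diag_mult_commute:
  fixes P Q :: "'a :: comm_semiring_0 mat"
  assumes "P \<in> carrier_mat n n" "Q \<in> carrier_mat n n"
  shows "(\<Sum>i<n. (P * Q) $$ (i, i)) = (\<Sum>i<n. (Q * P) $$ (i, i))"
proof -
  have "(\<Sum>i<n. (P * Q) $$ (i, i)) = (\<Sum>i<n. \<Sum>j<n. P $$ (i, j) * Q $$ (j, i))"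
    using assms by (simp add: scalar_prod_def lessThan_atLeast0)
  also have "\<dots> = (\<Sum>j<n. \<Sum>i<n. Q $$ (j, i) * P $$ (i, j))"
    by (subst sum.swap) (simp add: mult.commute)
  also have "\<dots> = (\<Sum>i<n. (Q * P) $$ (i, i))"
    using assms by (simp add: scalar_prod_def lessThan_atLeast0)
  finally show ?thesis .
qed

lemma adj_anticommutes_if_det_eq_0:
  fixes A X :: "'a :: {idom, ring_char_0} mat"
  assumes A: "A \<in> carrier_mat n n" and X: "X \<in> carrier_mat n n"
    and det0: "\<And>Y. Y \<in> carrier_mat n n \<Longrightarrow> det (A * Y + Y * A) = 0"
  shows "adj_mat (A * X + X * A) * A + A * adj_mat (A * X + X * A) = 0\<^sub>m n n"
proof (rule eq_matI)
  define M where "M = A * X + X * A"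
  have M: "M \<in> carrier_mat n n" using A X by (simp add: M_def)
  have adj: "adj_mat M \<in> carrier_mat n n" using adj_mat(1)[OF M] .
  fix p q assume "p < dim_row (0\<^sub>m n n :: 'a mat)" "q < dim_col (0\<^sub>m n n :: 'a mat)"
  then have p: "p < n" and q: "q < n" by simp_all
  \<comment> \<open>The indices are swapped on purpose: for the matrix unit with its 1 at
    \<open>(q, p)\<close>, the trace of \<open>C * E\<close> is the entry \<open>(p, q)\<close> of
    \<open>C\<close>.\<close>
  define E :: "'a mat" where "E = mat n n (\<lambda>(i, j). if i = q \<and> j = p then 1 else 0)"
  have E: "E \<in> carrier_mat n n" by (simp add: E_def)
  define N where "N = A * E + E * A"
  have N: "N \<in> carrier_mat n n" using A E by (simp add: N_def)
  \<comment> \<open>\<open>A * E\<close> carries column \<open>q\<close> of \<open>A\<close> in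
    column \<open>p\<close>, and \<open>E * A\<close> carries row \<open>p\<close> of
    \<open>A\<close> in row \<open>q\<close>.\<close>
  have Nij: "N $$ (i, j) = (if j = p then A $$ (i, q) else 0) + (if i = q then A $$ (p, j) else 0)"
    if "i < n" "j < n" for i j
  proof -
    have "(A * E) $$ (i, j) = (if j = p then A $$ (i, q) else 0)"
      using A q that by (simp add: E_def scalar_prod_def if_distrib[of "(*) _"] cong: if_cong)
    moreover have "(E * A) $$ (i, j) = (if i = q then A $$ (p, j) else 0)"
      using A p that by (simp add: E_def scalar_prod_def if_distribR if_distrib[of "\<lambda>x. x * _"] cong: if_cong)
    ultimately show ?thesis
      using A E p q that by (simp add: N_def del: index_mult_mat(1))
  qed
  \<comment> \<open>Since \<open>A * Y + Y * A\<close> is linear in \<open>Y\<close>, the whole line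
    through \<open>M\<close> in direction \<open>N\<close> consists of matrices covered by
    \<open>det0\<close>.\<close>
  have "M + t \<cdot>\<^sub>m N = A * (X + t \<cdot>\<^sub>m E) + (X + t \<cdot>\<^sub>m E) * A" for t
  proof -
    have "A * (X + t \<cdot>\<^sub>m E) = A * X + t \<cdot>\<^sub>m (A * E)" "(X + t \<cdot>\<^sub>m E) * A = X * A + t \<cdot>\<^sub>m (E * A)"
      using A X E by (simp_all add: mult_add_distrib_mat[of _ n n] add_mult_distrib_mat[of _ n n]
          mult_smult_distrib[of _ n n] mult_smult_assoc_mat[of _ n n])
    then show ?thesis
      using A X E unfolding M_def N_def
      by (intro eq_matI) (auto simp: algebra_simps simp del: index_mult_mat(1))
  qed
  then have "det (M + t \<cdot>\<^sub>m N) = 0" for t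
    using det0[of "X + t \<cdot>\<^sub>m E"] X E by simp
  then have "0 = (\<Sum>i<n. \<Sum>j<n. N $$ (i, j) * cofactor M i j)"
    using sum_cofactor_eq_0_if_det_line_eq_0[OF M N] by simp
  also have "\<dots> = (\<Sum>i<n. \<Sum>j<n. (if j = p then A $$ (i, q) * cofactor M i p else 0) +
      (if i = q then A $$ (p, j) * cofactor M q j else 0))"
    by (intro sum.cong refl) (auto simp: Nij distrib_right)
  also have "\<dots> = (\<Sum>i<n. A $$ (i, q) * cofactor M i p) +
      (\<Sum>i<n. \<Sum>j<n. if i = q then A $$ (p, j) * cofactor M q j else 0)"
    using p by (simp add: sum.distrib)
  also have "(\<Sum>i<n. \<Sum>j<n. if i = q then A $$ (p, j) * cofactor M q j else 0) =
      (\<Sum>j<n. A $$ (p, j) * cofactor M q j)"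
    using q by (subst sum.swap) simp
  \<comment> \<open>The adjugate is the transposed cofactor matrix: \<open>cofactor M i p\<close> is
    its entry \<open>(p, i)\<close> and \<open>cofactor M q j\<close> its entry
    \<open>(j, q)\<close>.\<close>
  also have "(\<Sum>i<n. A $$ (i, q) * cofactor M i p) + (\<Sum>j<n. A $$ (p, j) * cofactor M q j) =
      (adj_mat M * A + A * adj_mat M) $$ (p, q)"
    using A M adj p q
    by (auto simp: scalar_prod_def adj_mat_def lessThan_atLeast0 mult.commute intro!: sum.cong
        arg_cong2[of _ _ _ _ "(+)"])
  finally show "(adj_mat (A * X + X * A) * A + A * adj_mat (A * X + X * A)) $$ (p, q) =
      0\<^sub>m n n $$ (p, q)"
    using p q by (simp add: M_def)
qed (use A X adj_mat(1)[of "A * X + X * A" n] in auto)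

lemma det_eq_0_if_adj_anticommutes:
  fixes A X :: "'a :: {idom, ring_char_0} mat"
  assumes A: "A \<in> carrier_mat n n" and X: "X \<in> carrier_mat n n" and n: "n > 0"
    and adj0: "adj_mat (A * X + X * A) * A + A * adj_mat (A * X + X * A) = 0\<^sub>m n n"
  shows "det (A * X + X * A) = 0"
proof -
  define M where "M = A * X + X * A"
  have M: "M \<in> carrier_mat n n" using A X by (simp add: M_def)
  define C where "C = adj_mat M"
  have C: "C \<in> carrier_mat n n" using adj_mat(1)[OF M] by (simp add: C_def)
  \<comment> \<open>Trace of the identity
    \<open>M * adj_mat M = det M \<cdot>\<^sub>m 1\<^sub>m n\<close>.\<close>
  have "of_nat n * det M = (\<Sum>i<n. (M * C) $$ (i, i))"
    using adj_mat(2)[OF M] by (simp add: C_def)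
  also have "M * C = A * (X * C) + X * (A * C)"
    using A X C by (simp add: M_def add_mult_distrib_mat[of _ n n])
  also have "(\<Sum>i<n. (A * (X * C) + X * (A * C)) $$ (i, i)) =
      (\<Sum>i<n. (A * (X * C)) $$ (i, i)) + (\<Sum>i<n. (X * (A * C)) $$ (i, i))"
    using A X C by (simp add: sum.distrib del: index_mult_mat(1))
  \<comment> \<open>Cycling \<open>A\<close> to the end lets \<open>X\<close> be factored out on the
    left, leaving exactly the sum in \<open>adj0\<close>.\<close>
  also have "(\<Sum>i<n. (A * (X * C)) $$ (i, i)) = (\<Sum>i<n. (X * C * A) $$ (i, i))"
    using A X C by (intro sum_diag_mult_commute) auto
  also have "X * C * A = X * (C * A)"
    using A X C by simp
  also have "(\<Sum>i<n. (X * (C * A)) $$ (i, i)) + (\<Sum>i<n. (X * (A * C)) $$ (i, i)) =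
      (\<Sum>i<n. (X * (C * A + A * C)) $$ (i, i))"
    using A X C by (simp add: sum.distrib mult_add_distrib_mat[of _ n n _ n] del: index_mult_mat(1))
  also have "\<dots> = 0"
    using X adj0 by (simp add: C_def M_def del: index_mult_mat(1))
  \<comment> \<open>In characteristic 0 the factor \<open>of_nat n\<close> is nonzero for
    \<open>n > 0\<close> and cancels.\<close>
  finally show ?thesis
    using n by (simp add: M_def)
qed

theorem lemma2:
  fixes n :: nat
  assumes "n \<ge> 2"
  shows
    "(\<forall>A :: complex mat. A \<in> carrier_mat n n \<longrightarrow>
        ((\<forall>X \<in> carrier_mat n n. det (A * X + X * A) = 0) \<longleftrightarrow>
         (\<forall>X \<in> carrier_mat n n.
            adj_mat (A * X + X * A) * A + A * adj_mat (A * X + X * A) = 0\<^sub>m n n))) \<and>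
     (\<forall>A :: real mat. A \<in> carrier_mat n n \<longrightarrow>
        ((\<forall>X \<in> carrier_mat n n. det (A * X + X * A) = 0) \<longleftrightarrow>
         (\<forall>X \<in> carrier_mat n n.
            adj_mat (A * X + X * A) * A + A * adj_mat (A * X + X * A) = 0\<^sub>m n n)))"
  using assms
  by (auto intro: adj_anticommutes_if_det_eq_0 det_eq_0_if_adj_anticommutes)

end
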